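(* Let $k\ge 1$ be an integer and let $0<\varepsilon<1/2$. Put $\delta:=\varepsilon/2$ and $n_0:=2k/\varepsilon$. If $G$ is a $C_{2k+1}$-free graph on $n\ge n_0$ vertices with $e(G)\ge \left(\frac14-\delta\right)n^2$, then $G$ can be made bipartite by deleting at most $\varepsilon n^2$ edges.
   Context: All graphs are finite and simple; $e(G)$ is the number of edges of $G$. $C_{2k+1}$ is the cycle on $2k+1$ vertices. A graph is $F$-free if it does not contain a (not necessarily induced) subgraph isomorphic to $F$. *)

theory Defs
  imports Complex_Main
begin

text \<open>A graph is a pair \<open>(V, E)\<close> of a vertex set and a set of two-element subsets of it, so that
  there are no loops or multiple edges and \<open>card E\<close> is the number of (undirected) edges.\<close>

type_synonym 'a graph = "'a set \<times> 'a set set"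

abbreviation verts :: "'a graph \<Rightarrow> 'a set" where
  "verts G \<equiv> fst G"

abbreviation edges :: "'a graph \<Rightarrow> 'a set set" where
  "edges G \<equiv> snd G"

definition simple_graph :: "'a graph \<Rightarrow> bool" where
  "simple_graph G \<longleftrightarrow> finite (verts G) \<and> (\<forall>e\<in>edges G. e \<subseteq> verts G \<and> card e = 2)"

definition subgraph :: "'a graph \<Rightarrow> 'a graph \<Rightarrow> bool" where
  "subgraph H G \<longleftrightarrow> simple_graph H \<and> verts H \<subseteq> verts G \<and> edges H \<subseteq> edges G"

definition graph_iso :: "'a graph \<Rightarrow> 'b graph \<Rightarrow> bool" where
  "graph_iso F H \<longleftrightarrow>
     (\<exists>f. bij_betw f (verts F) (verts H) \<and>
          (\<forall>u\<in>verts F. \<forall>v\<in>verts F. {u, v} \<in> edges F \<longleftrightarrow> {f u, f v} \<in> edges H))"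

definition graph_free :: "'b graph \<Rightarrow> 'a graph \<Rightarrow> bool" where
  "graph_free F G \<longleftrightarrow> \<not> (\<exists>H. subgraph H G \<and> graph_iso F H)"

text \<open>The cycle on the vertices \<open>0, \<dots>, m - 1\<close>; this is a simple graph only for \<open>m \<ge> 3\<close>.\<close>

definition cycle_graph :: "nat \<Rightarrow> nat graph" where
  "cycle_graph m = ({..<m}, {{i, Suc i mod m} | i. i < m})"

definition bipartite :: "'a graph \<Rightarrow> bool" where
  "bipartite G \<longleftrightarrow>
     (\<exists>A B. A \<union> B = verts G \<and> A \<inter> B = {} \<and> (\<forall>e\<in>edges G. \<exists>a\<in>A. \<exists>b\<in>B. e = {a, b}))"

definition delete_edges :: "'a graph \<Rightarrow> 'a set set \<Rightarrow> 'a graph" where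
  "delete_edges G D = (verts G, edges G - D)"

end

theory Submission
  imports Defs
begin

text \<open>For a vertex \<open>x\<close> with neighbourhood \<open>N\<close>, delete the edges inside \<open>N\<close> and those inside its
  complement. Their number is
  \<open>e(G) - (\<Sum>v\<in>N. deg v) + 2 e(N)\<close>. As \<open>G\<close> has no \<open>C\<^bsub>2k+1\<^esub>\<close>, the neighbourhood \<open>N\<close> spans no
  path on \<open>2k\<close> vertices, so \<open>e(N) \<le> (k - 1) |N|\<close> by the Erdos--Gallai theorem. Averaging over all
  \<open>x\<close> and using the Cauchy--Schwarz inequality for \<open>\<Sum>v. (deg v)\<^sup>2\<close>, some \<open>x\<close> has at most
  \<open>e(G) (1 - 4 e(G) / n\<^sup>2 + 4 (k - 1) / n)\<close> such edges. Averaging is what makes \<open>n \<ge> 2k / \<epsilon>\<close>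
  sufficient; the choice of a vertex of maximum degree would lose a term of order \<open>k\<^sup>2\<close>.\<close>

section \<open>Counting adjacent ordered pairs\<close>

text \<open>Ordered pairs, as a double sum of 0/1 values, make the count additive in
  \<open>X\<close> and in \<open>Y\<close>; edges inside a set are therefore counted twice.\<close>

definition arcs :: "('a \<Rightarrow> 'a \<Rightarrow> bool) \<Rightarrow> 'a set \<Rightarrow> 'a set \<Rightarrow> nat" where
  "arcs r X Y = (\<Sum>u\<in>X. \<Sum>v\<in>Y. of_bool (r u v))"

lemma arcs_sym: "symp r \<Longrightarrow> arcs r X Y = arcs r Y X"
  unfolding arcs_def by (subst sum.swap) (intro sum.cong refl arg_cong[of _ _ of_bool], blast dest: sympD)

lemma arcs_split_left:
  "finite X \<Longrightarrow> Z \<subseteq> X \<Longrightarrow> arcs r X Y = arcs r Z Y + arcs r (X - Z) Y"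
  unfolding arcs_def by (subst sum.subset_diff[of Z X]) auto

lemma arcs_split_right:
  "finite Y \<Longrightarrow> Z \<subseteq> Y \<Longrightarrow> arcs r X Y = arcs r X Z + arcs r X (Y - Z)"
  unfolding arcs_def by (subst sum.subset_diff[of Z Y]) (auto simp: sum.distrib)

lemma arcs_split:
  assumes "symp r" "finite X" "Z \<subseteq> X"
  shows "arcs r X X = arcs r Z Z + 2 * arcs r Z (X - Z) + arcs r (X - Z) (X - Z)"
  using assms arcs_split_left[of X Z r X] arcs_split_right[of X Z r Z]
    arcs_split_right[of X Z r "X - Z"] arcs_sym[of r Z "X - Z"] by simp

lemma arcs_eq_sum_card:
  "finite Y \<Longrightarrow> arcs r X Y = (\<Sum>u\<in>X. card {v \<in> Y. r u v})"
  unfolding arcs_def by (simp add: of_bool_def flip: sum.inter_filter)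

section \<open>Paths as vertex lists and the Erdos--Gallai theorem\<close>

text \<open>The length of the list is the number of vertices, not of edges; empty and one-element
  lists count as paths.\<close>

definition is_path :: "('a \<Rightarrow> 'a \<Rightarrow> bool) \<Rightarrow> 'a list \<Rightarrow> bool" where
  "is_path r xs \<longleftrightarrow> distinct xs \<and> successively r xs"

lemma is_path_rev: "symp r \<Longrightarrow> is_path r (rev xs) \<longleftrightarrow> is_path r xs"
proof -
  assume "symp r"
  then have swap: "(\<lambda>x y. r y x) = r" by (auto simp: symp_def fun_eq_iff)
  show ?thesis unfolding is_path_def successively_rev swap distinct_rev by (rule refl)
qed

text \<open>Posa's rotation: the degree condition yields consecutive path vertices \<open>a\<close>, \<open>b\<close> such that
  \<open>b\<close> is adjacent to the first and \<open>a\<close> to the last vertex; reversing the part from \<open>b\<close> onwards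
  closes the path up.\<close>

lemma path_to_cycle:
  assumes "symp r" "irreflp r" "is_path r xs" "xs \<noteq> []"
    and "length xs \<le> card {v \<in> set xs. r (hd xs) v} + card {v \<in> set xs. r (last xs) v}"
  obtains cs where "is_path r cs" "set cs = set xs" "r (last cs) (hd cs)"
proof -
  let ?p = "length xs"
  \<comment> \<open>An index \<open>i\<close> stands for the consecutive pair \<open>xs ! i\<close>,
    \<open>xs ! Suc i\<close>. There are only \<open>?p - 1\<close> such pairs, while the two
    degrees add up to at least \<open>?p\<close>, so some pair lies in both sets.\<close>
  let ?A = "{i. i < ?p - 1 \<and> r (hd xs) (xs ! Suc i)}"
  let ?B = "{i. i < ?p - 1 \<and> r (last xs) (xs ! i)}"
  have hd: "hd xs = xs ! 0" and last: "last xs = xs ! (?p - 1)"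
    using assms(4) by (simp_all add: hd_conv_nth last_conv_nth)
  have irr: "\<not> r a a" for a using assms(2) by (simp add: irreflp_def)
  have "{v \<in> set xs. r (hd xs) v} \<subseteq> (\<lambda>i. xs ! Suc i) ` ?A"
  proof
    fix v assume v: "v \<in> {v \<in> set xs. r (hd xs) v}"
    then obtain j where j: "j < ?p" "v = xs ! j" by (auto simp: in_set_conv_nth)
    with v irr hd have "j \<noteq> 0" by (metis (mono_tags, lifting) mem_Collect_eq)
    then obtain i where "j = Suc i" by (cases j) auto
    with j v show "v \<in> (\<lambda>i. xs ! Suc i) ` ?A" by auto
  qed
  then have A: "card {v \<in> set xs. r (hd xs) v} \<le> card ?A"
    by (rule surj_card_le[rotated]) simp
  have "{v \<in> set xs. r (last xs) v} \<subseteq> (\<lambda>i. xs ! i) ` ?B"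
  proof
    fix v assume v: "v \<in> {v \<in> set xs. r (last xs) v}"
    then obtain j where j: "j < ?p" "v = xs ! j" by (auto simp: in_set_conv_nth)
    with v irr last have "j \<noteq> ?p - 1" by (metis (mono_tags, lifting) mem_Collect_eq)
    with j v show "v \<in> (\<lambda>i. xs ! i) ` ?B" by auto
  qed
  then have B: "card {v \<in> set xs. r (last xs) v} \<le> card ?B"
    by (rule surj_card_le[rotated]) simp
  have "?A \<inter> ?B \<noteq> {}"
  proof
    assume "?A \<inter> ?B = {}"
    then have "card ?A + card ?B = card (?A \<union> ?B)" by (simp add: card_Un_disjoint)
    also have "\<dots> \<le> card {..<?p - 1}" by (rule card_mono) auto
    finally have "card ?A + card ?B < ?p" using assms(4) by (cases xs) auto
    with A B assms(5) show False by linarith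
  qed
  then obtain i where i: "i < ?p - 1" "r (hd xs) (xs ! Suc i)" "r (last xs) (xs ! i)" by auto
  define ys zs where "ys = take (Suc i) xs" and "zs = drop (Suc i) xs"
  have xs: "xs = ys @ zs" by (simp add: ys_def zs_def)
  have ne: "ys \<noteq> []" "zs \<noteq> []" using i by (auto simp: ys_def zs_def)
  have "last ys = xs ! i" using i by (simp add: ys_def take_Suc_conv_app_nth)
  moreover have "hd zs = xs ! Suc i" using i by (simp add: zs_def hd_drop_conv_nth)
  ultimately have rr: "r (hd ys) (hd zs)" "r (last zs) (last ys)"
    using i ne by (simp_all add: xs)
  have "is_path r ys" "is_path r zs" "set ys \<inter> set zs = {}"
    using assms(3) by (auto simp: is_path_def xs successively_append_iff)
  moreover from this have "is_path r (rev zs)" using assms(1) by (simp add: is_path_rev)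
  ultimately have "is_path r (ys @ rev zs)"
    using sympD[OF assms(1) rr(2)] ne
    by (simp add: is_path_def successively_append_iff hd_rev del: successively_rev)
  moreover have "set (ys @ rev zs) = set xs" by (simp add: xs)
  moreover have "r (last (ys @ rev zs)) (hd (ys @ rev zs))"
    using rr ne assms(1) by (auto simp: last_rev dest: sympD)
  ultimately show ?thesis by (rule that)
qed

text \<open>Open the cycle just before \<open>c\<close> and put \<open>w\<close> in front: the
  closing edge of the cycle joins \<open>vs\<close> back to \<open>us\<close>.\<close>

lemma cycle_extend:
  assumes "symp r" "is_path r cs" "r (last cs) (hd cs)" "c \<in> set cs" "w \<notin> set cs" "r c w"
  obtains ps where "is_path r ps" "set ps = insert w (set cs)"
proof -
  obtain us vs where cs: "cs = us @ c # vs" using assms(4) by (auto simp: in_set_conv_decomp)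
  have "is_path r (w # c # vs @ us)"
    using assms(2-5) sympD[OF assms(1,6)] unfolding is_path_def cs
    by (cases us) (auto simp: successively_append_iff successively_Cons hd_append split: if_splits)
  then show ?thesis by (rule that) (auto simp: cs)
qed

text \<open>The Erdos--Gallai theorem; arcs count every edge twice.\<close>

lemma arcs_le_if_no_path:
  assumes "symp r" "irreflp r" "finite W"
    and "\<And>xs. is_path r xs \<Longrightarrow> set xs \<subseteq> W \<Longrightarrow> length xs < l"
  shows "arcs r W W \<le> (l - 2) * card W"
  using assms(3,4)
proof (induction W rule: finite_psubset_induct)
  case (psubset W)
  have IH: "arcs r U U \<le> (l - 2) * card U" if "U \<subset> W" for U
    using psubset.IH[OF that] psubset.prems that by blast
  have irr: "\<not> r a a" for a using assms(2) by (simp add: irreflp_def)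
  \<comment> \<open>A vertex of small degree can be removed by induction. If there is none, a
    longest path closes up to a cycle whose vertex set splits off from the rest of
    \<open>W\<close>.\<close>
  consider "W = {}" | v where "v \<in> W" "2 * card {u \<in> W. r v u} \<le> l - 2"
    | "W \<noteq> {}" "\<And>v. v \<in> W \<Longrightarrow> l - 2 < 2 * card {u \<in> W. r v u}"
    by (meson not_le)
  then show ?case
  proof cases
    case 1
    then show ?thesis by (simp add: arcs_def)
  next
    case (2 v)
    have "arcs r {v} (W - {v}) \<le> arcs r {v} W"
      using arcs_split_right[of W "{v}" r "{v}"] psubset.hyps 2 by simp
    also have "\<dots> = card {u \<in> W. r v u}" using psubset.hyps by (simp add: arcs_eq_sum_card)
    finally have "2 * arcs r {v} (W - {v}) \<le> l - 2" using 2 by linarith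
    moreover have "arcs r {v} {v} = 0" by (simp add: arcs_def irr)
    moreover have "arcs r (W - {v}) (W - {v}) \<le> (l - 2) * card (W - {v})"
      using 2 by (intro IH) auto
    moreover have "arcs r W W = arcs r {v} {v} + 2 * arcs r {v} (W - {v})
        + arcs r (W - {v}) (W - {v})"
      using arcs_split[of r W "{v}"] assms(1) psubset.hyps 2 by simp
    ultimately have "arcs r W W \<le> (l - 2) * Suc (card (W - {v}))" by simp
    then show ?thesis using 2 psubset.hyps by (metis card_Suc_Diff1)
  next
    case 3
    let ?P = "\<lambda>xs. is_path r xs \<and> set xs \<subseteq> W"
    obtain w where "w \<in> W" using 3 by auto
    then have "?P [w]" by (simp add: is_path_def)
    moreover have "\<forall>xs. ?P xs \<longrightarrow> length xs < l" using psubset.prems by blast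
    ultimately obtain xs where xs: "?P xs" and max: "\<And>ys. ?P ys \<Longrightarrow> length ys \<le> length xs"
      using ex_has_greatest_nat[of ?P "[w]" length l] by blast
    have "xs \<noteq> []" using max[of "[w]"] \<open>?P [w]\<close> by auto
    have len: "length xs < l" using xs psubset.prems by blast
    \<comment> \<open>By maximality no path on the same vertices can be prolonged at its head;
      applied to \<open>xs\<close> and \<open>rev xs\<close>, this puts all neighbours of both ends
      on the path.\<close>
    have in_set: "v \<in> set xs"
      if v: "v \<in> W" and "is_path r ys" "set ys = set xs" "ys \<noteq> []" "r (hd ys) v" for v ys
    proof (rule ccontr)
      assume "v \<notin> set xs"
      then have "?P (v # ys)"
        using that xs assms(1) by (auto simp: is_path_def successively_Cons dest: sympD)
      from max[OF this] have "length ys < length xs" by simp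
      then show False using that xs by (metis is_path_def distinct_card less_irrefl)
    qed
    have rev: "is_path r (rev xs)" using xs assms(1) by (simp add: is_path_rev)
    have "{v \<in> W. r (hd xs) v} = {v \<in> set xs. r (hd xs) v}"
      using xs in_set[of _ xs] \<open>xs \<noteq> []\<close> by auto
    moreover have "{v \<in> W. r (last xs) v} = {v \<in> set xs. r (last xs) v}"
      using xs in_set[OF _ rev] \<open>xs \<noteq> []\<close> by (auto simp: hd_rev)
    moreover have "hd xs \<in> W" "last xs \<in> W" using xs \<open>xs \<noteq> []\<close> by auto
    \<comment> \<open>Both end degrees are at least \<open>(l - 1) / 2\<close>, so their sum is at
      least \<open>l - 1\<close>, which bounds \<open>length xs\<close>.\<close>
    ultimately have
      "length xs \<le> card {v \<in> set xs. r (hd xs) v} + card {v \<in> set xs. r (last xs) v}"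
      using 3(2)[of "hd xs"] 3(2)[of "last xs"] len by simp
    then obtain cs where cs: "is_path r cs" "set cs = set xs" "r (last cs) (hd cs)"
      by (rule path_to_cycle[OF assms(1,2) conjunct1[OF xs] \<open>xs \<noteq> []\<close>])
    let ?C = "set xs"
    have card: "card ?C = length xs" using xs by (simp add: is_path_def distinct_card)
    \<comment> \<open>An edge leaving the cycle would give a path with one more vertex than the
      longest one.\<close>
    have "\<not> r c w" if "c \<in> ?C" "w \<in> W - ?C" for c w
    proof
      assume "r c w"
      have "c \<in> set cs" "w \<notin> set cs" using that cs(2) by auto
      then obtain ps where "is_path r ps" "set ps = insert w (set cs)"
        using \<open>r c w\<close> by (rule cycle_extend[OF assms(1) cs(1,3)])
      then have ps: "is_path r ps" "set ps = insert w ?C" by (simp_all add: cs(2))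
      then have "?P ps" using xs that by auto
      moreover have "length ps = Suc (length xs)"
        using distinct_card[of ps] ps that card by (simp add: is_path_def)
      ultimately show False using max[of ps] by simp
    qed
    then have "arcs r ?C (W - ?C) = 0" by (simp add: arcs_def)
    \<comment> \<open>The trivial degree bound suffices here, as \<open>?C\<close> has at most
      \<open>l - 1\<close> vertices.\<close>
    moreover have "arcs r ?C ?C \<le> (l - 2) * card ?C"
    proof -
      have "card {v \<in> ?C. r u v} \<le> l - 2" if "u \<in> ?C" for u
      proof -
        have "card {v \<in> ?C. r u v} \<le> card (?C - {u})" by (rule card_mono) (auto simp: irr)
        also have "\<dots> \<le> l - 2" using that card len by simp
        finally show ?thesis .
      qed
      then have "(\<Sum>u\<in>?C. card {v \<in> ?C. r u v}) \<le> (\<Sum>u\<in>?C. l - 2)" by (rule sum_mono)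
      then show ?thesis by (simp add: arcs_eq_sum_card mult.commute)
    qed
    moreover have "arcs r (W - ?C) (W - ?C) \<le> (l - 2) * card (W - ?C)"
      using xs \<open>xs \<noteq> []\<close> by (intro IH) (cases xs, auto)
    moreover have "card W = card ?C + card (W - ?C)"
      using xs psubset.hyps by (simp add: card_Diff_subset card_mono)
    ultimately show ?thesis
      using arcs_split[of r W ?C] assms(1) psubset.hyps xs by (simp add: distrib_left)
  qed
qed

section \<open>Forbidden cycles, edge counts and neighbourhoods\<close>

text \<open>Subgraphs need not be induced, so the image of \<open>F\<close> under \<open>f\<close>
  serves as the copy; non-edges of \<open>F\<close> may become edges of \<open>G\<close>.\<close>

lemma not_graph_free_if_embedding:
  assumes "simple_graph F" "inj_on f (verts F)" "f ` verts F \<subseteq> verts G"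
    and "\<And>e. e \<in> edges F \<Longrightarrow> f ` e \<in> edges G"
  shows "\<not> graph_free F G"
proof -
  let ?H = "(f ` verts F, (`) f ` edges F)"
  have sub: "e \<subseteq> verts F" "card e = 2" if "e \<in> edges F" for e
    using that assms(1) by (auto simp: simple_graph_def)
  have "card (f ` e) = 2" if "e \<in> edges F" for e
    using sub[OF that] assms(2) by (metis card_image inj_on_subset)
  then have "subgraph ?H G"
    using assms sub by (fastforce simp: subgraph_def simple_graph_def)
  moreover have "{u, v} \<in> edges F \<longleftrightarrow> {f u, f v} \<in> (`) f ` edges F"
    if "u \<in> verts F" "v \<in> verts F" for u v
  proof
    assume "{f u, f v} \<in> (`) f ` edges F"
    then obtain e where e: "e \<in> edges F" "f ` {u, v} = f ` e" by auto
    then have "{u, v} = e"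
      using inj_on_image_eq_iff[OF assms(2), of "{u, v}" e] sub that by simp
    with e show "{u, v} \<in> edges F" by simp
  qed (force intro: image_eqI[where x = "{u, v}"])
  ultimately show ?thesis
    using assms(2) unfolding graph_free_def graph_iso_def
    by (metis fst_conv inj_on_imp_bij_betw snd_conv)
qed

lemma simple_cycle_graph: "m \<ge> 3 \<Longrightarrow> simple_graph (cycle_graph m)"
proof -
  assume m: "m \<ge> 3"
  have "i \<noteq> Suc i mod m" if "i < m" for i
    using m that by (cases "Suc i = m") auto
  with m show ?thesis by (auto simp: simple_graph_def cycle_graph_def)
qed

lemma graph_free_cycle_no_cycle:
  assumes "graph_free (cycle_graph m) G" "m \<ge> 3" "is_path (\<lambda>u v. {u, v} \<in> edges G) cs"
    "set cs \<subseteq> verts G" "length cs = m"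
  shows "{last cs, hd cs} \<notin> edges G"
proof
  assume close: "{last cs, hd cs} \<in> edges G"
  have "cs \<noteq> []" using assms by auto
  have "{cs ! i, cs ! (Suc i mod m)} \<in> edges G" if "i < m" for i
  proof (cases "Suc i = m")
    case True
    then have "cs ! i = last cs" using assms(5) \<open>cs \<noteq> []\<close> by (auto simp: last_conv_nth)
    then show ?thesis
      using close True \<open>cs \<noteq> []\<close> by (simp add: hd_conv_nth)
  next
    case False
    then show ?thesis
      using assms(3,5) that by (auto simp: is_path_def successively_conv_nth)
  qed
  moreover have "inj_on ((!) cs) {..<m}"
    using assms(3,5) by (auto simp: is_path_def inj_on_def nth_eq_iff_index_eq)
  moreover have "(!) cs ` {..<m} \<subseteq> verts G" using assms(4,5) by auto
  ultimately have "\<not> graph_free (cycle_graph m) G"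
    by (intro not_graph_free_if_embedding[where f = "(!) cs"] simple_cycle_graph assms(2))
       (auto simp: cycle_graph_def)
  with assms(1) show False by simp
qed

text \<open>The adjacent ordered pairs are partitioned by their underlying edge, two to
  each.\<close>

lemma arcs_eq_twice_edges:
  assumes "simple_graph G" "S \<subseteq> verts G"
  shows "arcs (\<lambda>u v. {u, v} \<in> edges G) S S = 2 * card {e \<in> edges G. e \<subseteq> S}"
proof -
  let ?E = "{e \<in> edges G. e \<subseteq> S}"
  have fin: "finite S" using assms by (auto simp: simple_graph_def intro: finite_subset)
  then have finE: "finite ?E" using finite_subset[of ?E "Pow S"] by auto
  let ?T = "\<lambda>e. {(u, v). {u, v} = e}"
  have T: "finite (?T e) \<and> card (?T e) = 2" if "e \<in> ?E" for e
  proof -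
    have "card e = 2" using that assms(1) by (simp add: simple_graph_def)
    then obtain a b where "a \<noteq> b" "e = {a, b}" by (auto simp: card_2_iff)
    then have "?T e = {(a, b), (b, a)}" by (auto simp: doubleton_eq_iff)
    with \<open>a \<noteq> b\<close> show ?thesis by simp
  qed
  have "arcs (\<lambda>u v. {u, v} \<in> edges G) S S = card (SIGMA u:S. {v \<in> S. {u, v} \<in> edges G})"
    using fin by (simp add: arcs_eq_sum_card)
  also have "(SIGMA u:S. {v \<in> S. {u, v} \<in> edges G}) = (\<Union>e\<in>?E. ?T e)" by auto
  also have "card \<dots> = (\<Sum>e\<in>?E. card (?T e))"
    using finE T by (intro card_UN_disjoint) auto
  also have "\<dots> = 2 * card ?E" using T by simp
  finally show ?thesis .
qed

lemma bipartite_delete_inside_parts: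
  assumes "simple_graph G" "A \<subseteq> verts G"
  shows "bipartite (delete_edges G ({e \<in> edges G. e \<subseteq> A} \<union> {e \<in> edges G. e \<subseteq> verts G - A}))"
proof -
  have "\<exists>a\<in>A. \<exists>b\<in>verts G - A. e = {a, b}"
    if e: "e \<in> edges G" "\<not> e \<subseteq> A" "\<not> e \<subseteq> verts G - A" for e
  proof -
    obtain a b where "e = {a, b}" "e \<subseteq> verts G"
      using e assms(1) by (metis card_2_iff simple_graph_def)
    then show ?thesis using e by (cases "a \<in> A") auto
  qed
  then show ?thesis
    using assms(2) unfolding bipartite_def delete_edges_def
    by (intro exI[of _ A] exI[of _ "verts G - A"]) auto
qed

text \<open>A path on \<open>2 * k\<close> vertices inside \<open>N\<close> would close through
  \<open>x\<close> to a cycle on \<open>2 * k + 1\<close> vertices, so Erdos--Gallai applies with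
  \<open>l = 2 * k\<close>.\<close>

lemma arcs_neighbourhood_le:
  assumes "k \<ge> 1" "simple_graph G" "graph_free (cycle_graph (2 * k + 1)) G" "x \<in> verts G"
  defines "N \<equiv> {v \<in> verts G. {x, v} \<in> edges G}"
  shows "arcs (\<lambda>u v. {u, v} \<in> edges G) N N \<le> (2 * k - 2) * card N"
proof (rule arcs_le_if_no_path)
  let ?r = "\<lambda>u v. {u, v} \<in> edges G"
  have irr: "\<not> ?r a a" for a using assms(2) by (force simp: simple_graph_def)
  show "symp ?r" by (simp add: symp_def insert_commute)
  show "irreflp ?r" using irr by (simp add: irreflp_def)
  show "finite N" using assms(2) by (simp add: N_def simple_graph_def)
  fix xs assume xs: "is_path ?r xs" "set xs \<subseteq> N"
  show "length xs < 2 * k"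
  proof (rule ccontr)
    assume len: "\<not> length xs < 2 * k"
    \<comment> \<open>The forbidden cycle has an exact length, so a longer path is cut to
      \<open>2 * k\<close> vertices.\<close>
    define ys where "ys = take (2 * k) xs"
    have ys: "length ys = 2 * k" "ys \<noteq> []" "set ys \<subseteq> N" "is_path ?r ys"
      using len assms(1) xs set_take_subset[of "2 * k" xs]
        successively_append_iff[of ?r "take (2 * k) xs" "drop (2 * k) xs"]
      by (auto simp: ys_def is_path_def)
    then have adj: "?r x v" "v \<in> verts G" if "v \<in> set ys" for v using that by (auto simp: N_def)
    have "is_path ?r (x # ys)"
      using ys adj adj(1)[of x] irr[of x] by (auto simp: is_path_def successively_Cons)
    moreover have "set (x # ys) \<subseteq> verts G" using adj assms(4) by auto
    ultimately have "{last (x # ys), hd (x # ys)} \<notin> edges G"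
      using ys assms(1) by (intro graph_free_cycle_no_cycle[OF assms(3)]) auto
    moreover have "{last ys, x} \<in> edges G"
      using adj(1)[of "last ys"] ys(2) by (metis insert_commute last_in_set)
    ultimately show False using ys(2) by simp
  qed
qed

section \<open>Real inequalities\<close>

text \<open>Cauchy--Schwarz, obtained by summing the tangent-line bound for the square at the mean
  \<open>a\<close>.\<close>

lemma sum_squares_ge:
  fixes d :: "'a \<Rightarrow> real"
  assumes "card V = n" "n > 0"
  shows "(\<Sum>v\<in>V. d v)\<^sup>2 / n \<le> (\<Sum>v\<in>V. (d v)\<^sup>2)"
proof -
  define a where "a = (\<Sum>v\<in>V. d v) / n"
  have a: "(\<Sum>v\<in>V. d v) = a * n" using assms by (simp add: a_def)
  have "(\<Sum>v\<in>V. 2 * a * d v - a\<^sup>2) \<le> (\<Sum>v\<in>V. (d v)\<^sup>2)"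
  proof (rule sum_mono)
    fix v
    have "0 \<le> (d v - a)\<^sup>2" by (rule zero_le_power2)
    then show "2 * a * d v - a\<^sup>2 \<le> (d v)\<^sup>2" by (simp add: power2_diff algebra_simps)
  qed
  moreover have "(\<Sum>v\<in>V. 2 * a * d v - a\<^sup>2) = a\<^sup>2 * n"
    using assms a by (simp add: sum_subtractf power2_eq_square flip: sum_distrib_left)
  ultimately show ?thesis using assms by (simp add: a power2_eq_square)
qed

text \<open>Here \<open>y\<close> plays the role of the density \<open>m / n^2\<close>. With
  \<open>z = 1/4 - y\<close> the claim is a quadratic inequality: for \<open>z \<ge> 0\<close> it
  follows from \<open>z \<le> \<epsilon>/2\<close>, for \<open>z < 0\<close> from
  \<open>\<epsilon> < 1/2\<close>.\<close>

lemma density_bound: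
  fixes y \<epsilon> :: real
  assumes "0 < \<epsilon>" "\<epsilon> < 1/2" "y \<ge> 1/4 - \<epsilon>/2"
  shows "y * (1 - 4 * y + 2 * \<epsilon>) \<le> \<epsilon>"
proof -
  define z where "z = 1/4 - y"
  have "0 \<le> \<epsilon>/2 - z + 2 * \<epsilon> * z + 4 * z\<^sup>2"
  proof (cases "z \<ge> 0")
    case True
    then have "0 \<le> 2 * \<epsilon> * z" using assms by simp
    moreover have "0 \<le> 4 * z\<^sup>2" by simp
    ultimately show ?thesis using assms by (simp add: z_def)
  next
    case False
    then have "0 \<le> (- z) * (1 - 2 * \<epsilon>)" using assms by (intro mult_nonneg_nonneg) auto
    moreover have "0 \<le> 4 * z\<^sup>2" by simp
    moreover have "\<epsilon>/2 - z + 2 * \<epsilon> * z + 4 * z\<^sup>2 = \<epsilon>/2 + (- z) * (1 - 2 * \<epsilon>) + 4 * z\<^sup>2"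
      by (simp add: algebra_simps)
    ultimately show ?thesis using assms by linarith
  qed
  then show ?thesis by (simp add: z_def power2_eq_square algebra_simps)
qed

section \<open>Averaging the deleted edges over all vertices\<close>

theorem theorem4p8:
  fixes k :: nat and \<epsilon> \<delta> n0 :: real and G :: "'a graph" and n :: nat
  assumes "k \<ge> 1"
    and "0 < \<epsilon>" and "\<epsilon> < 1/2"
    and "\<delta> = \<epsilon> / 2"
    and "n0 = 2 * real k / \<epsilon>"
    and "simple_graph G"
    and "graph_free (cycle_graph (2 * k + 1)) G"
    and "card (verts G) = n"
    and "real n \<ge> n0"
    and "real (card (edges G)) \<ge> (1/4 - \<delta>) * (real n)^2"
  shows "\<exists>D. D \<subseteq> edges G \<and> real (card D) \<le> \<epsilon> * (real n)^2 \<and> bipartite (delete_edges G D)"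
proof -
  define r where "r = (\<lambda>u v. {u, v} \<in> edges G)"
  define V where "V = verts G"
  define N where "N x = {v \<in> V. r x v}" for x
  define d where "d x = card (N x)" for x
  define ins where "ins S = {e \<in> edges G. e \<subseteq> S}" for S
  define D where "D x = ins (N x) \<union> ins (V - N x)" for x
  define m where "m = card (edges G)"
  have finV: "finite V" using assms(6) by (simp add: simple_graph_def V_def)
  have symp: "symp r" by (simp add: symp_def r_def insert_commute)
  have arcs_ins: "arcs r S S = 2 * card (ins S)" if "S \<subseteq> V" for S
    using arcs_eq_twice_edges[OF assms(6)] that by (simp add: r_def V_def ins_def)
  have "ins V = edges G" using assms(6) by (auto simp: ins_def V_def simple_graph_def)
  then have arcsV: "arcs r V V = 2 * m" using arcs_ins[of V] by (simp add: m_def)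
  have arcs_d: "arcs r X V = (\<Sum>v\<in>X. d v)" for X
    using finV by (simp add: arcs_eq_sum_card d_def N_def)
  have sum_d: "(\<Sum>v\<in>V. d v) = 2 * m" using arcs_d arcsV by metis
  have card_D: "card (D x) + (\<Sum>v\<in>N x. d v) \<le> m + (2 * k - 2) * d x" if "x \<in> V" for x
  proof -
    have sub: "N x \<subseteq> V" by (auto simp: N_def)
    have "card (D x) \<le> card (ins (N x)) + card (ins (V - N x))"
      unfolding D_def by (rule card_Un_le)
    moreover have "arcs r (N x) (N x) \<le> (2 * k - 2) * d x"
      using arcs_neighbourhood_le[OF assms(1,6,7)] that by (simp add: V_def r_def N_def d_def)
    \<comment> \<open>The pairs between \<open>N x\<close> and its complement occur both in
      \<open>m\<close> and in the degree sum over \<open>N x\<close>; eliminating them leaves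
      \<open>m\<close> plus twice the number of edges inside \<open>N x\<close>.\<close>
    moreover have "2 * m = 2 * card (ins (N x)) + 2 * arcs r (N x) (V - N x)
        + 2 * card (ins (V - N x))"
      using arcs_split[OF symp finV sub] arcs_ins[OF sub] arcs_ins[of "V - N x"] arcsV by simp
    moreover have "(\<Sum>v\<in>N x. d v) = 2 * card (ins (N x)) + arcs r (N x) (V - N x)"
      using arcs_split_right[OF finV sub, of r "N x"] arcs_ins[OF sub] arcs_d by simp
    ultimately show ?thesis using arcs_ins[OF sub] by linarith
  qed
  have "0 < 2 * real k / \<epsilon>" using assms by simp
  then have n: "n > 0" using assms(5,9) by linarith
  \<comment> \<open>Double counting: \<open>d v\<close> is added once for each neighbour
    \<open>x\<close> of \<open>v\<close>.\<close>
  have "(\<Sum>x\<in>V. \<Sum>v\<in>N x. d v) = (\<Sum>v\<in>V. \<Sum>x\<in>{x \<in> V. r x v}. d v)"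
    unfolding N_def by (rule sum.swap_restrict[OF finV finV])
  also have "\<dots> = (\<Sum>v\<in>V. (d v)\<^sup>2)"
  proof (rule sum.cong[OF refl])
    fix v
    have "{x \<in> V. r x v} = N v" using symp by (auto simp: N_def dest: sympD)
    then show "(\<Sum>x\<in>{x \<in> V. r x v}. d v) = (d v)\<^sup>2" by (simp add: d_def power2_eq_square)
  qed
  finally have sum_sq: "(\<Sum>x\<in>V. \<Sum>v\<in>N x. d v) = (\<Sum>v\<in>V. (d v)\<^sup>2)" .
  have "(\<Sum>x\<in>V. card (D x) + (\<Sum>v\<in>N x. d v)) \<le> (\<Sum>x\<in>V. m + (2 * k - 2) * d x)"
    by (rule sum_mono) (rule card_D)
  then have "(\<Sum>x\<in>V. card (D x)) + (\<Sum>v\<in>V. (d v)\<^sup>2) \<le> n * m + (2 * k - 2) * (2 * m)"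
    using sum_sq sum_d assms(8) by (simp add: sum.distrib V_def flip: sum_distrib_left)
  then have "real ((\<Sum>x\<in>V. card (D x)) + (\<Sum>v\<in>V. (d v)\<^sup>2))
      \<le> real (n * m + (2 * k - 2) * (2 * m))"
    by (rule of_nat_mono)
  moreover have "(2 * real m)\<^sup>2 / n \<le> (\<Sum>v\<in>V. (real (d v))\<^sup>2)"
    using sum_squares_ge[of V n "\<lambda>v. real (d v)"] n assms(8) sum_d
    by (simp add: V_def flip: of_nat_sum)
  \<comment> \<open>The bound \<open>n \<ge> 2k / \<epsilon>\<close> absorbs the Erdos--Gallai term
    into one of order \<open>\<epsilon> * n * m\<close>.\<close>
  moreover have "real ((2 * k - 2) * (2 * m)) \<le> \<epsilon> * n * (2 * m)"
  proof -
    have "2 * real k \<le> \<epsilon> * n" using assms(2,5,9) by (simp add: pos_divide_le_eq mult.commute)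
    then have "real (2 * k - 2) \<le> \<epsilon> * n" by linarith
    then have "real (2 * k - 2) * real (2 * m) \<le> \<epsilon> * n * real (2 * m)"
      by (rule mult_right_mono) simp
    then show ?thesis by simp
  qed
  ultimately have sum_D: "(\<Sum>x\<in>V. real (card (D x)))
      \<le> real n * real m - (2 * real m)\<^sup>2 / n + \<epsilon> * n * (2 * real m)"
    by simp
  \<comment> \<open>In terms of the density \<open>y\<close>, the bound on the sum is
    \<open>n^3\<close> times the expression in \<open>density_bound\<close>.\<close>
  define y where "y = m / (real n)\<^sup>2"
  have m: "real m = y * (real n)\<^sup>2" using n by (simp add: y_def)
  have "y \<ge> 1/4 - \<epsilon>/2" using assms(10) n unfolding assms(4) by (simp add: y_def m_def pos_le_divide_eq)
  then have "y * (1 - 4 * y + 2 * \<epsilon>) \<le> \<epsilon>" by (rule density_bound[OF assms(2,3)])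
  then have "real n ^ 3 * (y * (1 - 4 * y + 2 * \<epsilon>)) \<le> real n ^ 3 * \<epsilon>"
    by (rule mult_left_mono) simp
  moreover have "real n * real m - (2 * real m)\<^sup>2 / n + \<epsilon> * n * (2 * real m)
      = real n ^ 3 * (y * (1 - 4 * y + 2 * \<epsilon>))"
    using n unfolding m by (simp add: field_simps power2_eq_square power3_eq_cube)
  ultimately have avg: "(\<Sum>x\<in>V. real (card (D x))) \<le> real n ^ 3 * \<epsilon>" using sum_D by simp
  have "\<exists>x\<in>V. real (card (D x)) \<le> \<epsilon> * (real n)\<^sup>2"
  proof (rule ccontr)
    assume "\<not> ?thesis"
    then have "(\<Sum>x\<in>V. \<epsilon> * (real n)\<^sup>2) < (\<Sum>x\<in>V. real (card (D x)))"
      using finV n assms(8) by (intro sum_strict_mono) (auto simp: V_def not_le)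
    with avg assms(8) show False
      by (simp add: V_def power2_eq_square power3_eq_cube algebra_simps)
  qed
  then obtain x where x: "x \<in> V" "real (card (D x)) \<le> \<epsilon> * (real n)\<^sup>2" by blast
  moreover have "D x \<subseteq> edges G" by (auto simp: D_def ins_def)
  moreover have "bipartite (delete_edges G (D x))"
    using bipartite_delete_inside_parts[OF assms(6), of "N x"]
    by (auto simp: D_def ins_def V_def N_def)
  ultimately show ?thesis by blast
qed

end
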